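(* For every nonstandard model $\mathcal M\models\mathrm{PA}$ there is a set $T\subseteq M$ such that $(\mathcal M,T)\models\mathrm{TB}^-(\mathcal L_{\mathrm{PA}})$ but $\mathrm{ElDiag}(\mathcal M,T)$ does not syntactically define $\mathrm{USB}^-(\mathcal L_{\mathrm{PA}})$ modulo $\mathcal L_{\mathrm{PA}}$.
   Context: $\mathcal L_{\mathrm{PA}}=\{0,1,+,\times,<\}$; $M$ is the universe of $\mathcal M$; $\underline{\ulcorner\phi\urcorner}$ is the numeral of the Gödel number of $\phi$. $\mathrm{TB}^-(\mathcal L_{\mathrm{PA}})$ is $\mathrm{PA}$ plus $T(\underline{\ulcorner\phi\urcorner})\leftrightarrow\phi$ for all $\mathcal L_{\mathrm{PA}}$-sentences $\phi$ ($T$ a fresh unary predicate). $\mathrm{USB}^-(\mathcal L_{\mathrm{PA}})$ is $\mathrm{PA}$ plus $\forall x\,(S(\underline{\ulcorner\phi\urcorner},x)\leftrightarrow\phi(x))$ for all $\mathcal L_{\mathrm{PA}}$-formulae $\phi(x)$ ($S$ a fresh binary predicate). In both, induction is assumed only for $\mathcal L_{\mathrm{PA}}$-formulae. $\mathrm{ElDiag}(\mathcal M,T)$ is the elementary diagram of the structure $(\mathcal M,T)$. It syntactically defines $\mathrm{USB}^-(\mathcal L_{\mathrm{PA}})$ modulo $\mathcal L_{\mathrm{PA}}$ if there is a formula $\theta(x,y)$ of $\mathcal L_{\mathrm{PA}}\cup\{T\}$ with parameters from $M$ such that $(\mathcal M,T)\models\Phi[\theta/S]$ for every axiom $\Phi$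 of $\mathrm{USB}^-(\mathcal L_{\mathrm{PA}})$ (arithmetical symbols left unchanged). *)

theory Defs
  imports Main "HOL-Library.Nat_Bijection"
begin

(* Terms and formulas over {0,1,+,*,<} together with a unary predicate symbol T, a binary
   predicate symbol S, and a constant Par a for every a :: 'a.  Variables are de Bruijn indices.
   The sublanguages in use are carved out by the predicates free_of_T and free_of_S and the set
   params of constants that occur. *)

datatype (tm_params: 'a) tm =
    Var nat
  | Par 'a
  | Zero  ("\<^bold>0")
  | One  ("\<^bold>1")
  | Plus "'a tm" "'a tm"  (infixl "\<^bold>+" 65)
  | Times "'a tm" "'a tm"  (infixl "\<^bold>*" 70)

datatype (params: 'a) fm =
    Eq "'a tm" "'a tm"  (infix "\<^bold>=" 50)
  | Less "'a tm" "'a tm"  (infix "\<^bold><" 50)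
  | TPred "'a tm"
  | SPred "'a tm" "'a tm"
  | Neg "'a fm"  ("\<^bold>\<not> _" [40] 40)
  | Conj "'a fm" "'a fm"  (infixr "\<^bold>\<and>" 35)
  | Forall "'a fm"

abbreviation Disj :: "'a fm \<Rightarrow> 'a fm \<Rightarrow> 'a fm"  (infixr "\<^bold>\<or>" 30)
  where "\<phi> \<^bold>\<or> \<psi> \<equiv> \<^bold>\<not> (\<^bold>\<not> \<phi> \<^bold>\<and> \<^bold>\<not> \<psi>)"

abbreviation Imp :: "'a fm \<Rightarrow> 'a fm \<Rightarrow> 'a fm"  (infixr "\<^bold>\<longrightarrow>" 25)
  where "\<phi> \<^bold>\<longrightarrow> \<psi> \<equiv> \<^bold>\<not> (\<phi> \<^bold>\<and> \<^bold>\<not> \<psi>)"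

abbreviation Iff :: "'a fm \<Rightarrow> 'a fm \<Rightarrow> 'a fm"  (infixr "\<^bold>\<longleftrightarrow>" 25)
  where "\<phi> \<^bold>\<longleftrightarrow> \<psi> \<equiv> (\<phi> \<^bold>\<longrightarrow> \<psi>) \<^bold>\<and> (\<psi> \<^bold>\<longrightarrow> \<phi>)"

abbreviation Exists :: "'a fm \<Rightarrow> 'a fm"
  where "Exists \<phi> \<equiv> \<^bold>\<not> (Forall (\<^bold>\<not> \<phi>))"

primrec fv_tm :: "'a tm \<Rightarrow> nat set" where
  "fv_tm (Var i) = {i}"
| "fv_tm (Par a) = {}"
| "fv_tm \<^bold>0 = {}"
| "fv_tm \<^bold>1 = {}"
| "fv_tm (s \<^bold>+ t) = fv_tm s \<union> fv_tm t"
| "fv_tm (s \<^bold>* t) = fv_tm s \<union> fv_tm t"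

primrec fv :: "'a fm \<Rightarrow> nat set" where
  "fv (s \<^bold>= t) = fv_tm s \<union> fv_tm t"
| "fv (s \<^bold>< t) = fv_tm s \<union> fv_tm t"
| "fv (TPred t) = fv_tm t"
| "fv (SPred s t) = fv_tm s \<union> fv_tm t"
| "fv (\<^bold>\<not> \<phi>) = fv \<phi>"
| "fv (\<phi> \<^bold>\<and> \<psi>) = fv \<phi> \<union> fv \<psi>"
| "fv (Forall \<phi>) = {i. Suc i \<in> fv \<phi>}"

abbreviation sentence :: "'a fm \<Rightarrow> bool"
  where "sentence \<phi> \<equiv> fv \<phi> = {}"

primrec free_of_T :: "'a fm \<Rightarrow> bool" where
  "free_of_T (s \<^bold>= t) = True"
| "free_of_T (s \<^bold>< t) = True"
| "free_of_T (TPred t) = False"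
| "free_of_T (SPred s t) = True"
| "free_of_T (\<^bold>\<not> \<phi>) = free_of_T \<phi>"
| "free_of_T (\<phi> \<^bold>\<and> \<psi>) = (free_of_T \<phi> \<and> free_of_T \<psi>)"
| "free_of_T (Forall \<phi>) = free_of_T \<phi>"

primrec free_of_S :: "'a fm \<Rightarrow> bool" where
  "free_of_S (s \<^bold>= t) = True"
| "free_of_S (s \<^bold>< t) = True"
| "free_of_S (TPred t) = True"
| "free_of_S (SPred s t) = False"
| "free_of_S (\<^bold>\<not> \<phi>) = free_of_S \<phi>"
| "free_of_S (\<phi> \<^bold>\<and> \<psi>) = (free_of_S \<phi> \<and> free_of_S \<psi>)"
| "free_of_S (Forall \<phi>) = free_of_S \<phi>"

definition LPA :: "'a fm set"
  where "LPA = {\<phi>. free_of_T \<phi> \<and> free_of_S \<phi> \<and> params \<phi> = {}}"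

(* Simultaneous capture-avoiding substitution of terms for the free variables. *)

primrec subst_tm :: "(nat \<Rightarrow> 'a tm) \<Rightarrow> 'a tm \<Rightarrow> 'a tm" where
  "subst_tm \<sigma> (Var i) = \<sigma> i"
| "subst_tm \<sigma> (Par a) = Par a"
| "subst_tm \<sigma> \<^bold>0 = \<^bold>0"
| "subst_tm \<sigma> \<^bold>1 = \<^bold>1"
| "subst_tm \<sigma> (s \<^bold>+ t) = subst_tm \<sigma> s \<^bold>+ subst_tm \<sigma> t"
| "subst_tm \<sigma> (s \<^bold>* t) = subst_tm \<sigma> s \<^bold>* subst_tm \<sigma> t"

definition lift :: "(nat \<Rightarrow> 'a tm) \<Rightarrow> nat \<Rightarrow> 'a tm"
  where "lift \<sigma> = case_nat (Var 0) (\<lambda>i. subst_tm (\<lambda>j. Var (Suc j)) (\<sigma> i))"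

primrec subst :: "(nat \<Rightarrow> 'a tm) \<Rightarrow> 'a fm \<Rightarrow> 'a fm" where
  "subst \<sigma> (s \<^bold>= t) = (subst_tm \<sigma> s \<^bold>= subst_tm \<sigma> t)"
| "subst \<sigma> (s \<^bold>< t) = (subst_tm \<sigma> s \<^bold>< subst_tm \<sigma> t)"
| "subst \<sigma> (TPred t) = TPred (subst_tm \<sigma> t)"
| "subst \<sigma> (SPred s t) = SPred (subst_tm \<sigma> s) (subst_tm \<sigma> t)"
| "subst \<sigma> (\<^bold>\<not> \<phi>) = (\<^bold>\<not> subst \<sigma> \<phi>)"
| "subst \<sigma> (\<phi> \<^bold>\<and> \<psi>) = (subst \<sigma> \<phi> \<^bold>\<and> subst \<sigma> \<psi>)"
| "subst \<sigma> (Forall \<phi>) = Forall (subst (lift \<sigma>) \<phi>)"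

(* replace_S \<theta> \<Phi> is \<Phi>[\<theta>/S], where x and y in \<theta>(x,y) are the variables 0 and 1.  Any
   parameters of \<theta> are constants Par a, so \<theta> has no further free variables and nothing
   has to be lifted under the quantifiers of \<Phi>. *)

primrec replace_S :: "'a fm \<Rightarrow> 'a fm \<Rightarrow> 'a fm" where
  "replace_S \<theta> (s \<^bold>= t) = (s \<^bold>= t)"
| "replace_S \<theta> (s \<^bold>< t) = (s \<^bold>< t)"
| "replace_S \<theta> (TPred t) = TPred t"
| "replace_S \<theta> (SPred s t) = subst (\<lambda>i. if i = 0 then s else t) \<theta>"
| "replace_S \<theta> (\<^bold>\<not> \<phi>) = (\<^bold>\<not> replace_S \<theta> \<phi>)"
| "replace_S \<theta> (\<phi> \<^bold>\<and> \<psi>) = (replace_S \<theta> \<phi> \<^bold>\<and> replace_S \<theta> \<psi>)"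
| "replace_S \<theta> (Forall \<phi>) = Forall (replace_S \<theta> \<phi>)"

(* The universe of a structure is the whole type 'a. *)

record 'a arith_structure =
  m_zero :: 'a
  m_one :: 'a
  m_plus :: "'a \<Rightarrow> 'a \<Rightarrow> 'a"
  m_times :: "'a \<Rightarrow> 'a \<Rightarrow> 'a"
  m_less :: "'a \<Rightarrow> 'a \<Rightarrow> bool"

primrec val :: "'a arith_structure \<Rightarrow> (nat \<Rightarrow> 'a) \<Rightarrow> 'a tm \<Rightarrow> 'a" where
  "val M e (Var i) = e i"
| "val M e (Par a) = a"
| "val M e \<^bold>0 = m_zero M"
| "val M e \<^bold>1 = m_one M"
| "val M e (s \<^bold>+ t) = m_plus M (val M e s) (val M e t)"
| "val M e (s \<^bold>* t) = m_times M (val M e s) (val M e t)"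

primrec sat :: "'a arith_structure \<Rightarrow> 'a set \<Rightarrow> ('a \<times> 'a) set \<Rightarrow> (nat \<Rightarrow> 'a) \<Rightarrow> 'a fm \<Rightarrow> bool" where
  "sat M T S e (s \<^bold>= t) \<longleftrightarrow> val M e s = val M e t"
| "sat M T S e (s \<^bold>< t) \<longleftrightarrow> m_less M (val M e s) (val M e t)"
| "sat M T S e (TPred t) \<longleftrightarrow> val M e t \<in> T"
| "sat M T S e (SPred s t) \<longleftrightarrow> (val M e s, val M e t) \<in> S"
| "sat M T S e (\<^bold>\<not> \<phi>) \<longleftrightarrow> \<not> sat M T S e \<phi>"
| "sat M T S e (\<phi> \<^bold>\<and> \<psi>) \<longleftrightarrow> sat M T S e \<phi> \<and> sat M T S e \<psi>"
| "sat M T S e (Forall \<phi>) \<longleftrightarrow> (\<forall>a. sat M T S (case_nat a e) \<phi>)"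

(* Truth of sentences in M and in the expansion (M,T).  The values of the symbols that these
   structures do not interpret are irrelevant: they do not occur in the sentences to which the
   two definitions are applied. *)

definition true_in :: "'a arith_structure \<Rightarrow> 'a fm \<Rightarrow> bool"
  where "true_in M \<phi> \<longleftrightarrow> (\<forall>e. sat M {} {} e \<phi>)"

definition true_in_expansion :: "'a arith_structure \<Rightarrow> 'a set \<Rightarrow> 'a fm \<Rightarrow> bool"
  where "true_in_expansion M T \<phi> \<longleftrightarrow> (\<forall>e. sat M T {} e \<phi>)"

(* Peano arithmetic: the axioms of (non-negative parts of) discretely ordered rings, plus the
   induction scheme for formulas of LPA. *)

definition discretely_ordered_semiring_axioms :: "'a fm set" where
  "discretely_ordered_semiring_axioms =
     (let x = Var 0; y = Var 1; z = Var 2 in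
      {(x \<^bold>+ y) \<^bold>+ z \<^bold>= x \<^bold>+ (y \<^bold>+ z),
       x \<^bold>+ y \<^bold>= y \<^bold>+ x,
       (x \<^bold>* y) \<^bold>* z \<^bold>= x \<^bold>* (y \<^bold>* z),
       x \<^bold>* y \<^bold>= y \<^bold>* x,
       x \<^bold>* (y \<^bold>+ z) \<^bold>= x \<^bold>* y \<^bold>+ x \<^bold>* z,
       x \<^bold>+ \<^bold>0 \<^bold>= x,
       x \<^bold>* \<^bold>0 \<^bold>= \<^bold>0,
       x \<^bold>* \<^bold>1 \<^bold>= x,
       x \<^bold>< y \<^bold>\<and> y \<^bold>< z \<^bold>\<longrightarrow> x \<^bold>< z,
       \<^bold>\<not> x \<^bold>< x,
       x \<^bold>< y \<^bold>\<or> x \<^bold>= y \<^bold>\<or> y \<^bold>< x,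
       x \<^bold>< y \<^bold>\<longrightarrow> x \<^bold>+ z \<^bold>< y \<^bold>+ z,
       \<^bold>0 \<^bold>< z \<^bold>\<and> x \<^bold>< y \<^bold>\<longrightarrow> x \<^bold>* z \<^bold>< y \<^bold>* z,
       x \<^bold>< y \<^bold>\<longrightarrow> Exists (Var 1 \<^bold>+ Var 0 \<^bold>= Var 2),
       \<^bold>0 \<^bold>< \<^bold>1,
       \<^bold>0 \<^bold>< x \<^bold>\<longrightarrow> \<^bold>1 \<^bold>< x \<^bold>\<or> \<^bold>1 \<^bold>= x,
       \<^bold>0 \<^bold>< x \<^bold>\<or> \<^bold>0 \<^bold>= x})"

(* Induction on the variable 0 of \<phi>. *)

definition induction_axiom :: "'a fm \<Rightarrow> 'a fm" where
  "induction_axiom \<phi> =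
     (subst (case_nat \<^bold>0 Var) \<phi>
        \<^bold>\<and> Forall (\<phi> \<^bold>\<longrightarrow> subst (case_nat (Var 0 \<^bold>+ \<^bold>1) (\<lambda>i. Var (Suc i))) \<phi>)
      \<^bold>\<longrightarrow> Forall \<phi>)"

(* The prefixes Forall ^^ n form universal closures, so that PA consists of sentences. *)

definition PA :: "'a fm set" where
  "PA = {(Forall ^^ 3) \<phi> | \<phi>. \<phi> \<in> discretely_ordered_semiring_axioms}
      \<union> {(Forall ^^ n) (induction_axiom \<phi>) | n \<phi>. \<phi> \<in> LPA \<and> fv \<phi> \<subseteq> {..n}}"

definition standard_model :: "nat arith_structure"
  where "standard_model = \<lparr>m_zero = 0, m_one = 1, m_plus = (+), m_times = (*), m_less = (<)\<rparr>"

definition isomorphism :: "('a \<Rightarrow> 'b) \<Rightarrow> 'a arith_structure \<Rightarrow> 'b arith_structure \<Rightarrow> bool" where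
  "isomorphism f M N \<longleftrightarrow> bij f \<and> f (m_zero M) = m_zero N \<and> f (m_one M) = m_one N
     \<and> (\<forall>a b. f (m_plus M a b) = m_plus N (f a) (f b))
     \<and> (\<forall>a b. f (m_times M a b) = m_times N (f a) (f b))
     \<and> (\<forall>a b. m_less M a b \<longleftrightarrow> m_less N (f a) (f b))"

definition nonstandard :: "'a arith_structure \<Rightarrow> bool"
  where "nonstandard M \<longleftrightarrow> \<not> (\<exists>f. isomorphism f standard_model M)"

primrec numeral_tm :: "nat \<Rightarrow> 'a tm" where
  "numeral_tm 0 = \<^bold>0"
| "numeral_tm (Suc n) = numeral_tm n \<^bold>+ \<^bold>1"

(* Goedel numbers are only meant for members of LPA. *)

primrec goedel_tm :: "'a tm \<Rightarrow> nat" where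
  "goedel_tm (Var i) = prod_encode (0, i)"
| "goedel_tm (Par a) = undefined"
| "goedel_tm \<^bold>0 = prod_encode (1, 0)"
| "goedel_tm \<^bold>1 = prod_encode (2, 0)"
| "goedel_tm (s \<^bold>+ t) = prod_encode (3, prod_encode (goedel_tm s, goedel_tm t))"
| "goedel_tm (s \<^bold>* t) = prod_encode (4, prod_encode (goedel_tm s, goedel_tm t))"

primrec goedel :: "'a fm \<Rightarrow> nat" where
  "goedel (s \<^bold>= t) = prod_encode (0, prod_encode (goedel_tm s, goedel_tm t))"
| "goedel (s \<^bold>< t) = prod_encode (1, prod_encode (goedel_tm s, goedel_tm t))"
| "goedel (TPred t) = undefined"
| "goedel (SPred s t) = undefined"
| "goedel (\<^bold>\<not> \<phi>) = prod_encode (2, goedel \<phi>)"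
| "goedel (\<phi> \<^bold>\<and> \<psi>) = prod_encode (3, prod_encode (goedel \<phi>, goedel \<psi>))"
| "goedel (Forall \<phi>) = prod_encode (4, goedel \<phi>)"

lemma inj_on_goedel: "inj_on goedel LPA"
proof -
  have tm: "s = t" if "goedel_tm s = goedel_tm t" "tm_params s = {}" "tm_params t = {}"
    for s t :: "'a tm"
    using that by (induction s arbitrary: t) (case_tac t; simp)+
  have "\<phi> = \<psi>" if "goedel \<phi> = goedel \<psi>" "\<phi> \<in> LPA" "\<psi> \<in> LPA" for \<phi> \<psi> :: "'a fm"
    using that unfolding LPA_def
    by (induction \<phi> arbitrary: \<psi>) (case_tac \<psi>; simp add: tm)+
  then show ?thesis by (auto intro: inj_onI)
qed

definition TB :: "'a fm set" where
  "TB = PA \<union> {TPred (numeral_tm (goedel \<phi>)) \<^bold>\<longleftrightarrow> \<phi> | \<phi>. \<phi> \<in> LPA \<and> sentence \<phi>}"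

definition USB :: "'a fm set" where
  "USB = PA \<union> {Forall (SPred (numeral_tm (goedel \<phi>)) (Var 0) \<^bold>\<longleftrightarrow> \<phi>) | \<phi>. \<phi> \<in> LPA \<and> fv \<phi> \<subseteq> {0}}"

definition ElDiag :: "'a arith_structure \<Rightarrow> 'a set \<Rightarrow> 'a fm set" where
  "ElDiag M T = {\<phi>. free_of_S \<phi> \<and> sentence \<phi> \<and> true_in_expansion M T \<phi>}"

(* For U deductively closed, such as ElDiag M T: membership then is provability. *)

definition syntactically_defines_USB :: "'a fm set \<Rightarrow> bool" where
  "syntactically_defines_USB U \<longleftrightarrow>
     (\<exists>\<theta>. free_of_S \<theta> \<and> fv \<theta> \<subseteq> {0, 1} \<and> (\<forall>\<Phi>\<in>USB. replace_S \<theta> \<Phi> \<in> U))"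

lemma fv_tm_subst: "fv_tm (subst_tm \<sigma> t) = (\<Union>i\<in>fv_tm t. fv_tm (\<sigma> i))"
  by (induction t) auto

lemma fv_subst: "fv (subst \<sigma> \<phi>) = (\<Union>i\<in>fv \<phi>. fv_tm (\<sigma> i))"
proof (induction \<phi> arbitrary: \<sigma>)
  case (Forall \<phi>)
  have "Suc k \<in> fv_tm (lift \<sigma> i) \<longleftrightarrow> (\<exists>j. i = Suc j \<and> k \<in> fv_tm (\<sigma> j))" for k i
    by (cases i) (auto simp: lift_def fv_tm_subst)
  then show ?case by (force simp: Forall)
qed (auto simp: fv_tm_subst)

lemma fv_replace_S:
  assumes "fv \<theta> \<subseteq> {0, 1}"
  shows "fv (replace_S \<theta> \<phi>) \<subseteq> fv \<phi>"
  by (induction \<phi>) (use assms in \<open>auto simp: fv_subst split: if_splits\<close>)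

lemma free_of_S_subst: "free_of_S (subst \<sigma> \<phi>) = free_of_S \<phi>"
  by (induction \<phi> arbitrary: \<sigma>) auto

lemma free_of_S_replace_S: "free_of_S \<theta> \<Longrightarrow> free_of_S (replace_S \<theta> \<phi>)"
  by (induction \<phi>) (auto simp: free_of_S_subst)

lemma fv_Forall_iterate: "fv ((Forall ^^ n) \<phi>) = {i. i + n \<in> fv \<phi>}"
  by (induction n arbitrary: \<phi>) (auto simp: funpow_swap1)

lemma fv_numeral_tm [simp]: "fv_tm (numeral_tm n) = {}"
  by (induction n) auto

lemma sentence_PA:
  assumes "\<Phi> \<in> PA"
  shows "sentence \<Phi>"
proof -
  have ind: "i + n \<notin> fv (induction_axiom \<phi>)" if "fv \<phi> \<subseteq> {..n}" for i n and \<phi> :: "'a fm"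
  proof -
    have "Suc (i + n) \<notin> fv \<phi>" using that by auto
    then show ?thesis
      using that by (auto simp: induction_axiom_def fv_subst split: nat.splits)
  qed
  have "i + 3 \<notin> fv \<phi>" if "\<phi> \<in> discretely_ordered_semiring_axioms" for i and \<phi> :: "'a fm"
    using that unfolding discretely_ordered_semiring_axioms_def Let_def
    by (elim insertE emptyE) auto
  with assms ind show ?thesis by (auto simp: PA_def fv_Forall_iterate)
qed

lemma sentence_USB: "\<Phi> \<in> USB \<Longrightarrow> sentence \<Phi>"
  by (auto simp: USB_def dest: sentence_PA)

(* Membership in the elementary diagram amounts to plain truth of the translated axioms. *)

lemma syntactically_defines_USB_ElDiag:
  "syntactically_defines_USB (ElDiag M T) \<longleftrightarrow>
     (\<exists>\<theta>. free_of_S \<theta> \<and> fv \<theta> \<subseteq> {0, 1}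
        \<and> (\<forall>\<Phi>\<in>USB. true_in_expansion M T (replace_S \<theta> \<Phi>)))"
proof -
  have "sentence (replace_S \<theta> \<Phi>)" if "fv \<theta> \<subseteq> {0, 1}" "\<Phi> \<in> USB" for \<theta> \<Phi> :: "'a fm"
    using fv_replace_S[OF that(1)] sentence_USB[OF that(2)] by blast
  then show ?thesis
    by (auto simp: syntactically_defines_USB_def ElDiag_def free_of_S_replace_S)
qed

end

(* T is the set of numerals of Goedel numbers of true sentences; the only property used against
   definability is that T lies in the standard cut.  Let theta(x,y) define satisfaction in (M,T).
   For each fixed k, winning the k-round Ehrenfeucht-Fraisse game on M with all elements below v
   named is expressible by a formula of LPA in v.  For standard v the game has finitely many
   classes, so among the elements <u,<v,p>>, p coding the parameters of theta, two distinct ones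
   are equivalent (keeping <v,p> fixed).  By overspill this also holds for some nonstandard v = d.
   Take the least z = <u,<d,p>> that is equivalent to some smaller z' of the same form: being such
   a repetition is an LPA-property of z that z' lacks.  But T lies below d, so for k large
   compared with theta the formula theta cannot distinguish z from z'. *)

theory Submission
  imports Defs
begin

section \<open>Satisfaction, substitution and the language of arithmetic\<close>

lemma val_cong: "(\<And>i. i \<in> fv_tm t \<Longrightarrow> e i = e' i) \<Longrightarrow> val M e t = val M e' t"
  by (induction t) auto

lemma sat_cong: "(\<And>i. i \<in> fv \<phi> \<Longrightarrow> e i = e' i) \<Longrightarrow> sat M T S e \<phi> = sat M T S e' \<phi>"
proof (induction \<phi> arbitrary: e e')
  case (Forall \<phi>)
  have "sat M T S (case_nat a e) \<phi> = sat M T S (case_nat a e') \<phi>" for a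
    by (rule Forall.IH) (auto split: nat.split intro: Forall.prems)
  then show ?case by simp
next
  case (Conj \<phi> \<psi>)
  have "sat M T S e \<phi> = sat M T S e' \<phi>" "sat M T S e \<psi> = sat M T S e' \<psi>"
    by (rule Conj.IH; simp add: Conj.prems)+
  then show ?case by simp
next
  case (Neg \<phi>)
  have "sat M T S e \<phi> = sat M T S e' \<phi>"
    by (rule Neg.IH) (simp add: Neg.prems)
  then show ?case by simp
next
  case (Eq s t)
  then show ?case using val_cong[of s e e' M] val_cong[of t e e' M] by simp
next
  case (Less s t)
  then show ?case using val_cong[of s e e' M] val_cong[of t e e' M] by simp
next
  case (TPred s)
  then show ?case using val_cong[of s e e' M] by simp
next
  case (SPred s t)
  then show ?case using val_cong[of s e e' M] val_cong[of t e e' M] by simp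
qed

lemma val_subst_tm: "val M e (subst_tm \<sigma> t) = val M (\<lambda>i. val M e (\<sigma> i)) t"
  by (induction t) auto

lemma sat_subst: "sat M T S e (subst \<sigma> \<phi>) = sat M T S (\<lambda>i. val M e (\<sigma> i)) \<phi>"
proof (induction \<phi> arbitrary: e \<sigma>)
  case (Forall \<phi>)
  have "(\<lambda>i. val M (case_nat a e) (lift \<sigma> i)) = case_nat a (\<lambda>i. val M e (\<sigma> i))" for a
    by (auto simp: fun_eq_iff lift_def val_subst_tm split: nat.split)
  then show ?case by (simp add: Forall)
qed (auto simp: val_subst_tm)

lemma sat_free: "free_of_T \<phi> \<Longrightarrow> free_of_S \<phi> \<Longrightarrow> sat M T S e \<phi> = sat M T' S' e \<phi>"
  by (induction \<phi> arbitrary: e) auto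

lemma free_of_T_subst [simp]: "free_of_T (subst \<sigma> \<phi>) = free_of_T \<phi>"
  by (induction \<phi> arbitrary: \<sigma>) auto

lemma tm_params_subst: "tm_params (subst_tm \<sigma> t) \<subseteq> tm_params t \<union> (\<Union>i. tm_params (\<sigma> i))"
  by (induction t) auto

lemma params_subst: "params (subst \<sigma> \<phi>) \<subseteq> params \<phi> \<union> (\<Union>i. tm_params (\<sigma> i))"
proof (induction \<phi> arbitrary: \<sigma>)
  case (Forall \<phi>)
  have "(\<Union>i. tm_params (lift \<sigma> i)) \<subseteq> (\<Union>i. tm_params (\<sigma> i))"
  proof -
    have "tm_params (lift \<sigma> i) \<subseteq> (\<Union>i. tm_params (\<sigma> i))" for i
      using tm_params_subst[of "\<lambda>j. Var (Suc j)"]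
      by (cases i) (fastforce simp: lift_def)+
    then show ?thesis by blast
  qed
  with Forall[of "lift \<sigma>"] show ?case by auto
qed (use tm_params_subst in \<open>fastforce+\<close>)

lemma subst_in_LPA:
  assumes "\<phi> \<in> LPA" "\<And>i. tm_params (\<sigma> i) = {}"
  shows "subst \<sigma> \<phi> \<in> LPA"
  using assms params_subst[of \<sigma> \<phi>] by (auto simp: LPA_def free_of_S_subst)

lemma LPA_simps [simp]:
  "(s \<^bold>= t) \<in> LPA \<longleftrightarrow> tm_params s = {} \<and> tm_params t = {}"
  "(s \<^bold>< t) \<in> LPA \<longleftrightarrow> tm_params s = {} \<and> tm_params t = {}"
  "(\<^bold>\<not> \<phi>) \<in> LPA \<longleftrightarrow> \<phi> \<in> LPA"
  "(\<phi> \<^bold>\<and> \<psi>) \<in> LPA \<longleftrightarrow> \<phi> \<in> LPA \<and> \<psi> \<in> LPA"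
  "Forall \<phi> \<in> LPA \<longleftrightarrow> \<phi> \<in> LPA"
  by (auto simp: LPA_def)

lemma Forall_iterate_in_LPA [simp]: "(Forall ^^ n) \<phi> \<in> LPA \<longleftrightarrow> \<phi> \<in> LPA"
  by (induction n) auto

lemma sat_LPA: "\<phi> \<in> LPA \<Longrightarrow> sat M T S e \<phi> = sat M {} {} e \<phi>"
  by (rule sat_free) (auto simp: LPA_def)

lemma induction_axiom_in_LPA: "\<phi> \<in> LPA \<Longrightarrow> induction_axiom \<phi> \<in> LPA"
  unfolding induction_axiom_def by (auto intro!: subst_in_LPA split: nat.splits)

lemma PA_subset_LPA: "PA \<subseteq> LPA"
proof -
  have "discretely_ordered_semiring_axioms \<subseteq> LPA"
    unfolding discretely_ordered_semiring_axioms_def Let_def by simp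
  then show ?thesis by (auto simp: PA_def induction_axiom_in_LPA)
qed

lemma replace_S_LPA: "\<phi> \<in> LPA \<Longrightarrow> replace_S \<theta> \<phi> = \<phi>"
proof -
  have "free_of_S \<phi> \<Longrightarrow> replace_S \<theta> \<phi> = \<phi>" by (induction \<phi>) auto
  then show "\<phi> \<in> LPA \<Longrightarrow> replace_S \<theta> \<phi> = \<phi>" by (simp add: LPA_def)
qed

lemma finite_fv_tm: "finite (fv_tm t)"
  by (induction t) auto

lemma finite_fv: "finite (fv \<phi>)"
proof (induction \<phi>)
  case (Forall \<phi>)
  have "{i. Suc i \<in> fv \<phi>} = Suc -` fv \<phi>" by auto
  then show ?case using Forall by (simp add: finite_vimageI)
qed (auto simp: finite_fv_tm)

lemma finite_tm_params: "finite (tm_params t)"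
  by (induction t) auto

lemma finite_params: "finite (params \<phi>)"
  by (induction \<phi>) (auto simp: finite_tm_params)

lemma sat_Forall_iterate:
  assumes "\<And>e. sat M T S e ((Forall ^^ n) \<phi>)"
  shows "sat M T S e \<phi>"
  using assms
proof (induction n arbitrary: e)
  case (Suc n)
  have "sat M T S e' ((Forall ^^ n) \<phi>)" for e'
  proof -
    \<comment> \<open>Every assignment is its own tail extended by its value at 0, so it is covered
      by the stripped quantifier.\<close>
    have "sat M T S (case_nat (e' 0) (\<lambda>i. e' (Suc i))) ((Forall ^^ n) \<phi>)"
      using Suc.prems[of "\<lambda>i. e' (Suc i)"] by simp
    moreover have "case_nat (e' 0) (\<lambda>i. e' (Suc i)) = e'"
      by (auto simp: fun_eq_iff split: nat.split)
    ultimately show ?thesis by simp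
  qed
  then show ?case by (rule Suc.IH)
qed simp

text \<open>Renaming finitely many classes by naturals. The recursion over rounds classifies tuples
  by sets of earlier classes; renaming keeps the type of the classification fixed.\<close>

lemma finite_range_to_nat:
  assumes "finite (g ` A)"
  shows "\<exists>f :: 'b \<Rightarrow> nat. finite (f ` A) \<and> (\<forall>x\<in>A. \<forall>y\<in>A. f x = f y \<longrightarrow> g x = g y)"
proof -
  obtain h :: "_ \<Rightarrow> nat" where h: "inj_on h (g ` A)"
    using assms finite_imp_inj_to_nat_seg by meson
  have "finite ((\<lambda>x. h (g x)) ` A)"
    using finite_imageI[OF assms, of h] by (simp add: image_image)
  moreover have "g x = g y" if "x \<in> A" "y \<in> A" "h (g x) = h (g y)" for x y
    using that h by (auto dest: inj_onD)
  ultimately show ?thesis by blast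
qed

section \<open>Ordered arithmetic in a model of PA\<close>

locale pa_model =
  fixes M :: "'a arith_structure"
  assumes PA_true: "\<Phi> \<in> PA \<Longrightarrow> true_in M \<Phi>"
begin

abbreviation zero :: 'a  ("\<zero>") where "\<zero> \<equiv> m_zero M"
abbreviation one :: 'a  ("\<one>") where "\<one> \<equiv> m_one M"
abbreviation plus :: "'a \<Rightarrow> 'a \<Rightarrow> 'a"  (infixl "\<oplus>" 65) where "x \<oplus> y \<equiv> m_plus M x y"
abbreviation times :: "'a \<Rightarrow> 'a \<Rightarrow> 'a"  (infixl "\<otimes>" 70) where "x \<otimes> y \<equiv> m_times M x y"
abbreviation less :: "'a \<Rightarrow> 'a \<Rightarrow> bool"  (infix "\<prec>" 50) where "x \<prec> y \<equiv> m_less M x y"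

lemma semiring_axiom_true:
  assumes "\<phi> \<in> discretely_ordered_semiring_axioms"
  shows "sat M {} {} e \<phi>"
proof -
  have "true_in M ((Forall ^^ 3) \<phi>)" using assms by (intro PA_true) (auto simp: PA_def)
  then show ?thesis by (auto simp: true_in_def intro: sat_Forall_iterate[where n = 3])
qed

lemma semiring_axioms:
  shows add_assoc: "x \<oplus> y \<oplus> z = x \<oplus> (y \<oplus> z)"
    and add_comm: "x \<oplus> y = y \<oplus> x"
    and mult_comm: "x \<otimes> y = y \<otimes> x"
    and distrib: "x \<otimes> (y \<oplus> z) = x \<otimes> y \<oplus> x \<otimes> z"
    and add_zero: "x \<oplus> \<zero> = x"
    and mult_zero: "x \<otimes> \<zero> = \<zero>"
    and mult_one: "x \<otimes> \<one> = x"
    and less_trans: "x \<prec> y \<Longrightarrow> y \<prec> z \<Longrightarrow> x \<prec> z"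
    and less_irrefl: "\<not> x \<prec> x"
    and less_linear: "x \<prec> y \<or> x = y \<or> y \<prec> x"
    and add_less_mono: "x \<prec> y \<Longrightarrow> x \<oplus> z \<prec> y \<oplus> z"
    and mult_less_mono: "\<zero> \<prec> z \<Longrightarrow> x \<prec> y \<Longrightarrow> x \<otimes> z \<prec> y \<otimes> z"
    and less_imp_add: "x \<prec> y \<Longrightarrow> \<exists>z. x \<oplus> z = y"
    and zero_less_one: "\<zero> \<prec> \<one>"
    and discrete: "\<zero> \<prec> x \<Longrightarrow> \<one> \<prec> x \<or> \<one> = x"
    and zero_least: "\<zero> \<prec> x \<or> \<zero> = x"
proof -
  let ?e = "\<lambda>i::nat. if i = 0 then x else if i = 1 then y else z"
  have ax: "\<forall>\<phi>\<in>discretely_ordered_semiring_axioms. sat M {} {} ?e \<phi>"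
    using semiring_axiom_true by blast
  note ax = ax[unfolded discretely_ordered_semiring_axioms_def Let_def ball_simps, simplified]
  show "x \<oplus> y \<oplus> z = x \<oplus> (y \<oplus> z)" "x \<oplus> y = y \<oplus> x"
    "x \<otimes> y = y \<otimes> x" "x \<otimes> (y \<oplus> z) = x \<otimes> y \<oplus> x \<otimes> z" "x \<oplus> \<zero> = x" "x \<otimes> \<zero> = \<zero>" "x \<otimes> \<one> = x"
    "x \<prec> y \<Longrightarrow> y \<prec> z \<Longrightarrow> x \<prec> z" "\<not> x \<prec> x" "x \<prec> y \<or> x = y \<or> y \<prec> x"
    "x \<prec> y \<Longrightarrow> x \<oplus> z \<prec> y \<oplus> z" "\<zero> \<prec> z \<Longrightarrow> x \<prec> y \<Longrightarrow> x \<otimes> z \<prec> y \<otimes> z"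
    "x \<prec> y \<Longrightarrow> \<exists>z. x \<oplus> z = y" "\<zero> \<prec> \<one>" "\<zero> \<prec> x \<Longrightarrow> \<one> \<prec> x \<or> \<one> = x" "\<zero> \<prec> x \<or> \<zero> = x"
    using ax by blast+
qed

lemma less_asym: "x \<prec> y \<Longrightarrow> \<not> y \<prec> x"
  using less_trans less_irrefl by blast

lemma not_less_zero: "\<not> x \<prec> \<zero>"
  using zero_least less_irrefl less_asym by metis

lemma zero_add: "\<zero> \<oplus> x = x"
  by (metis add_comm add_zero)

lemma add_left_cancel: "x \<oplus> y = x \<oplus> z \<Longrightarrow> y = z"
  by (metis less_linear less_irrefl add_less_mono add_comm)

lemma less_add_one: "x \<prec> x \<oplus> \<one>"
  by (metis zero_less_one add_less_mono add_comm zero_add)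

text \<open>By discreteness the difference of an element above \<open>y\<close> and \<open>y\<close>
  itself is at least one, which leaves no room below the successor.\<close>

lemma less_add_one_iff: "x \<prec> y \<oplus> \<one> \<longleftrightarrow> x \<prec> y \<or> x = y"
proof
  assume "x \<prec> y \<oplus> \<one>"
  moreover have False if yx: "y \<prec> x" and xy: "x \<prec> y \<oplus> \<one>"
  proof -
    obtain c where c: "y \<oplus> c = x" using less_imp_add[OF yx] by blast
    have "\<zero> \<prec> c" using zero_least[of c] c yx add_zero less_irrefl by metis
    then have "\<one> \<prec> c \<or> \<one> = c" by (rule discrete)
    then have "y \<oplus> \<one> \<prec> x \<or> y \<oplus> \<one> = x" using c add_less_mono[of \<one> c y] by (auto simp: add_comm)
    then show False using xy less_asym less_irrefl by blast
  qed
  ultimately show "x \<prec> y \<or> x = y" using less_linear by blast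
next
  show "x \<prec> y \<or> x = y \<Longrightarrow> x \<prec> y \<oplus> \<one>" using less_add_one less_trans by blast
qed

lemma less_add_mono: "x \<prec> y \<Longrightarrow> x \<prec> y \<oplus> z"
  using zero_least[of z] add_less_mono[of \<zero> z y] less_trans[of x y "y \<oplus> z"]
  by (auto simp: zero_add add_zero add_comm)

lemma self_le_add: "x \<prec> x \<oplus> y \<or> x = x \<oplus> y"
  using zero_least[of y] add_less_mono[of \<zero> y x] by (auto simp: zero_add add_zero add_comm)

section \<open>An injective pairing given by a term\<close>

text \<open>A variant of Cantor pairing without the division by two, so that a term of the language
  computes it. It is injective but not onto.\<close>

definition pair :: "'a \<Rightarrow> 'a \<Rightarrow> 'a"
  where "pair x y = (x \<oplus> y) \<otimes> (x \<oplus> y) \<oplus> x"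

text \<open>With s = x + y the value lies between the square of s and the square of s + 1, because x
  is at most s. So pairs with different sums occupy disjoint intervals.\<close>

lemma pair_mono:
  assumes "x \<oplus> y \<prec> x' \<oplus> y'"
  shows "pair x y \<prec> pair x' y'"
proof -
  define s s' where "s = x \<oplus> y" and "s' = x' \<oplus> y'"
  have pos: "\<zero> \<prec> s \<oplus> \<one>"
    using zero_least[of s] less_add_one[of s] less_trans by metis
  have "s \<otimes> s \<oplus> x \<prec> (s \<oplus> \<one>) \<otimes> (s \<oplus> \<one>)"
  proof -
    have "(s \<oplus> \<one>) \<otimes> (s \<oplus> \<one>) = (s \<oplus> \<one>) \<otimes> s \<oplus> (s \<oplus> \<one>)" by (simp add: distrib mult_one)
    also have "(s \<oplus> \<one>) \<otimes> s = s \<otimes> s \<oplus> s"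
      by (metis distrib mult_comm mult_one)
    finally have eq: "(s \<oplus> \<one>) \<otimes> (s \<oplus> \<one>) = s \<oplus> (s \<oplus> \<one>) \<oplus> s \<otimes> s"
      by (metis add_assoc add_comm)
    have "x \<prec> s \<oplus> \<one>" using self_le_add[of x y] by (simp add: less_add_one_iff s_def)
    then have "x \<prec> s \<oplus> (s \<oplus> \<one>)" by (metis less_add_mono add_comm)
    then show ?thesis unfolding eq using add_less_mono[of x _ "s \<otimes> s"] by (metis add_comm)
  qed
  moreover have "(s \<oplus> \<one>) \<otimes> (s \<oplus> \<one>) \<prec> s' \<otimes> s' \<or> (s \<oplus> \<one>) \<otimes> (s \<oplus> \<one>) = s' \<otimes> s'"
  proof -
    have le: "s \<oplus> \<one> \<prec> s' \<or> s \<oplus> \<one> = s'"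
    proof -
      have "\<not> s' \<prec> s \<oplus> \<one>"
        using assms less_asym less_irrefl by (auto simp: less_add_one_iff s_def s'_def)
      then show ?thesis using less_linear by blast
    qed
    show ?thesis
    proof (cases "s \<oplus> \<one> = s'")
      case False
      with le have l: "s \<oplus> \<one> \<prec> s'" by blast
      have "(s \<oplus> \<one>) \<otimes> (s \<oplus> \<one>) \<prec> s' \<otimes> (s \<oplus> \<one>)" by (rule mult_less_mono[OF pos l])
      moreover have "(s \<oplus> \<one>) \<otimes> s' \<prec> s' \<otimes> s'" using mult_less_mono[OF less_trans[OF pos l] l] .
      ultimately show ?thesis using mult_comm less_trans by metis
    qed simp
  qed
  ultimately have "s \<otimes> s \<oplus> x \<prec> s' \<otimes> s'" using less_trans by metis
  then show ?thesis unfolding pair_def s_def[symmetric] s'_def[symmetric] by (rule less_add_mono)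
qed

text \<open>Monotonicity in the sum forces equal sums; cancelling the common square then yields the
  first component.\<close>

lemma pair_inject: "pair x y = pair x' y' \<longleftrightarrow> x = x' \<and> y = y'"
proof
  assume eq: "pair x y = pair x' y'"
  then have s: "x \<oplus> y = x' \<oplus> y'"
    using pair_mono less_linear less_irrefl by metis
  with eq have "x = x'" unfolding pair_def using add_left_cancel by metis
  with s show "x = x' \<and> y = y'" using add_left_cancel by blast
qed simp

definition pair_tm :: "'a tm \<Rightarrow> 'a tm \<Rightarrow> 'a tm"
  where "pair_tm s t = (s \<^bold>+ t) \<^bold>* (s \<^bold>+ t) \<^bold>+ s"

lemma pair_tm_simps [simp]:
  "val M e (pair_tm s t) = pair (val M e s) (val M e t)"
  "tm_params (pair_tm s t) = tm_params s \<union> tm_params t"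
  "fv_tm (pair_tm s t) = fv_tm s \<union> fv_tm t"
  by (auto simp: pair_tm_def pair_def)

section \<open>Induction and least elements for arithmetical formulas\<close>

text \<open>Elements of the model enter as parameters through the assignment \<open>e\<close>,
  because formulas in \<open>LPA\<close> contain no constants \<open>Par\<close>.\<close>

lemma definable_induct:
  assumes "\<phi> \<in> LPA" "sat M {} {} (case_nat \<zero> e) \<phi>"
    and "\<And>a. sat M {} {} (case_nat a e) \<phi> \<Longrightarrow> sat M {} {} (case_nat (a \<oplus> \<one>) e) \<phi>"
  shows "sat M {} {} (case_nat a e) \<phi>"
proof -
  \<comment> \<open>A closure prefix long enough for the finitely many free variables turns the
    instance into an axiom of \<open>PA\<close>.\<close>
  obtain n where "fv \<phi> \<subseteq> {..n}"
    using finite_fv[of \<phi>] by (auto simp: finite_nat_set_iff_bounded_le)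
  then have "true_in M ((Forall ^^ n) (induction_axiom \<phi>))"
    using assms(1) by (intro PA_true) (auto simp: PA_def)
  then have ax: "sat M {} {} e (induction_axiom \<phi>)"
    by (auto simp: true_in_def intro: sat_Forall_iterate[where n = n])
  have "(\<lambda>i. val M e (case_nat \<^bold>0 Var i)) = case_nat \<zero> e"
    by (auto simp: fun_eq_iff split: nat.split)
  moreover have "(\<lambda>i. val M (case_nat a e) (case_nat (Var 0 \<^bold>+ \<^bold>1) (\<lambda>i. Var (Suc i)) i))
      = case_nat (a \<oplus> \<one>) e" for a
    by (auto simp: fun_eq_iff split: nat.split)
  ultimately show ?thesis
    using ax assms(2,3) by (auto simp: induction_axiom_def sat_subst)
qed

text \<open>Without a least witness, induction on \<open>b\<close> shows that no element below
  \<open>b\<close> satisfies the formula, for every \<open>b\<close>.\<close>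

lemma definable_least:
  assumes "\<phi> \<in> LPA" "sat M {} {} (case_nat a e) \<phi>"
  shows "\<exists>b. sat M {} {} (case_nat b e) \<phi> \<and> (\<forall>c. c \<prec> b \<longrightarrow> \<not> sat M {} {} (case_nat c e) \<phi>)"
proof (rule ccontr)
  assume no_least: "\<not> ?thesis"
  \<comment> \<open>Under the new quantifier 0 is the smaller element and 1 the bound, so the value
    \<open>e i\<close> is found at index \<open>i + 2\<close>.\<close>
  let ?\<sigma> = "case_nat (Var 0) (\<lambda>i. Var (i + 2)) :: nat \<Rightarrow> 'a tm"
  let ?\<psi> = "Forall (Var 0 \<^bold>< Var 1 \<^bold>\<longrightarrow> \<^bold>\<not> subst ?\<sigma> \<phi>)"
  have "(\<lambda>i. val M (case_nat c (case_nat b e)) (?\<sigma> i)) = case_nat c e" for b c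
    by (auto simp: fun_eq_iff split: nat.split)
  then have \<psi>: "sat M {} {} (case_nat b e) ?\<psi>
      \<longleftrightarrow> (\<forall>c. c \<prec> b \<longrightarrow> \<not> sat M {} {} (case_nat c e) \<phi>)" for b
    by (simp only: sat.simps sat_subst val.simps) simp
  have "sat M {} {} (case_nat (a \<oplus> \<one>) e) ?\<psi>"
  proof (rule definable_induct)
    show "?\<psi> \<in> LPA"
      using assms(1) by (auto intro!: subst_in_LPA split: nat.splits)
    show "sat M {} {} (case_nat \<zero> e) ?\<psi>"
      unfolding \<psi> by (simp add: not_less_zero)
    show "sat M {} {} (case_nat (b \<oplus> \<one>) e) ?\<psi>" if "sat M {} {} (case_nat b e) ?\<psi>" for b
      using that no_least unfolding \<psi> less_add_one_iff by blast
  qed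
  then show False using assms(2) less_add_one unfolding \<psi> by blast
qed

section \<open>The standard cut\<close>

primrec num :: "nat \<Rightarrow> 'a" where
  "num 0 = \<zero>"
| "num (Suc n) = num n \<oplus> \<one>"

lemma val_numeral_tm [simp]: "val M e (numeral_tm n) = num n"
  by (induction n) auto

lemma num_mono: "m < n \<Longrightarrow> num m \<prec> num n"
  by (induction n) (auto simp: less_add_one_iff less_Suc_eq)

lemma num_less_iff: "num m \<prec> num n \<longleftrightarrow> m < n"
  by (metis num_mono less_asym less_irrefl linorder_neqE_nat)

lemma inj_num: "inj num"
  by (rule injI) (metis num_mono less_irrefl linorder_neqE_nat)

lemma num_add: "num (m + n) = num m \<oplus> num n"
  by (induction n) (auto simp: add_zero add_assoc)

lemma num_mult: "num (m * n) = num m \<otimes> num n"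
  by (induction n) (auto simp: mult_zero mult_one distrib num_add add_comm)

text \<open>If \<open>num n\<close> is below \<open>d\<close>, discreteness puts its successor at or
  below \<open>d\<close>, and equality would make \<open>d\<close> standard.\<close>

lemma num_less_nonstandard: "d \<notin> range num \<Longrightarrow> num n \<prec> d"
proof (induction n)
  case 0
  then show ?case using zero_least[of d] by (metis num.simps(1) rangeI)
next
  case (Suc n)
  then have "\<not> d \<prec> num n \<oplus> \<one>"
    using less_asym by (auto simp: less_add_one_iff)
  then show ?case using Suc.prems less_linear by (metis num.simps(2) rangeI)
qed

text \<open>The numerals form an initial segment. This finiteness is what bounds the number of game
  classes at a standard bound.\<close>

lemma finite_below_num: "finite {x. x \<prec> num n}"
proof (rule finite_subset)
  show "{x. x \<prec> num n} \<subseteq> num ` {..<n}"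
  proof
    fix x assume x: "x \<in> {x. x \<prec> num n}"
    then have "x \<in> range num" using num_less_nonstandard less_asym by blast
    with x show "x \<in> num ` {..<n}" by (auto simp: num_less_iff)
  qed
qed simp

text \<open>The numeral map preserves the structure and is injective, so surjectivity alone makes it
  an isomorphism.\<close>

lemma surj_num_imp_standard: "surj num \<Longrightarrow> \<not> nonstandard M"
proof -
  assume "surj num"
  then have "isomorphism num standard_model M"
    using inj_num
    by (auto simp: isomorphism_def bij_def standard_model_def num_add num_mult num_less_iff zero_add)
  then show ?thesis by (auto simp: nonstandard_def)
qed

section \<open>Ehrenfeucht-Fraisse games with named elements\<close>

text \<open>Sum and product are compared through their graphs, hence three pairs. The first two
  clauses fix every element below \<open>d\<close>, which treats these elements as
  constants.\<close>

definition agree :: "'a \<Rightarrow> 'a \<times> 'a \<Rightarrow> 'a \<times> 'a \<Rightarrow> 'a \<times> 'a \<Rightarrow> bool" where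
  "agree d = (\<lambda>(a, b) (a', b') (a'', b''). (a \<prec> d \<longrightarrow> a = b) \<and> (b \<prec> d \<longrightarrow> a = b)
     \<and> (a = \<zero> \<longleftrightarrow> b = \<zero>) \<and> (a = \<one> \<longleftrightarrow> b = \<one>) \<and> (a = a' \<longleftrightarrow> b = b') \<and> (a \<prec> a' \<longleftrightarrow> b \<prec> b')
     \<and> (a \<oplus> a' = a'' \<longleftrightarrow> b \<oplus> b' = b'') \<and> (a \<otimes> a' = a'' \<longleftrightarrow> b \<otimes> b' = b''))"

definition partial_iso :: "'a \<Rightarrow> ('a \<times> 'a) set \<Rightarrow> bool"
  where "partial_iso d R \<longleftrightarrow> (\<forall>x\<in>R. \<forall>y\<in>R. \<forall>z\<in>R. agree d x y z)"

lemma partial_isoD: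
  assumes "partial_iso d R" "(a, b) \<in> R"
  shows "a \<prec> d \<or> b \<prec> d \<Longrightarrow> a = b" "a = \<zero> \<longleftrightarrow> b = \<zero>" "a = \<one> \<longleftrightarrow> b = \<one>"
    and "(a', b') \<in> R \<Longrightarrow> a = a' \<longleftrightarrow> b = b'" "(a', b') \<in> R \<Longrightarrow> a \<prec> a' \<longleftrightarrow> b \<prec> b'"
    and "(a', b') \<in> R \<Longrightarrow> (a'', b'') \<in> R \<Longrightarrow> a \<oplus> a' = a'' \<longleftrightarrow> b \<oplus> b' = b''"
    and "(a', b') \<in> R \<Longrightarrow> (a'', b'') \<in> R \<Longrightarrow> a \<otimes> a' = a'' \<longleftrightarrow> b \<otimes> b' = b''"
proof -
  have *: "agree d (a, b) y z" if "y \<in> R" "z \<in> R" for y z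
    using assms that by (simp add: partial_iso_def)
  show "a \<prec> d \<or> b \<prec> d \<Longrightarrow> a = b" "a = \<zero> \<longleftrightarrow> b = \<zero>" "a = \<one> \<longleftrightarrow> b = \<one>"
    using *[OF assms(2,2)] unfolding agree_def prod.case by blast+
  show "(a', b') \<in> R \<Longrightarrow> a = a' \<longleftrightarrow> b = b'" "(a', b') \<in> R \<Longrightarrow> a \<prec> a' \<longleftrightarrow> b \<prec> b'"
    using *[of "(a', b')" "(a', b')"] by (simp_all add: agree_def)
  show "(a', b') \<in> R \<Longrightarrow> (a'', b'') \<in> R \<Longrightarrow> a \<oplus> a' = a'' \<longleftrightarrow> b \<oplus> b' = b''"
    "(a', b') \<in> R \<Longrightarrow> (a'', b'') \<in> R \<Longrightarrow> a \<otimes> a' = a'' \<longleftrightarrow> b \<otimes> b' = b''"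
    using *[of "(a', b')" "(a'', b'')"] by (simp_all add: agree_def)
qed

text \<open>The position \<open>R\<close> is won by the duplicator in the \<open>k\<close>-round Ehrenfeucht-Fraisse game on
  \<open>M\<close> with all elements below \<open>d\<close> named.\<close>

primrec back_forth :: "nat \<Rightarrow> 'a \<Rightarrow> ('a \<times> 'a) set \<Rightarrow> bool" where
  "back_forth 0 d R \<longleftrightarrow> partial_iso d R"
| "back_forth (Suc k) d R \<longleftrightarrow> (\<forall>a. \<exists>b. back_forth k d (insert (a, b) R))
     \<and> (\<forall>b. \<exists>a. back_forth k d (insert (a, b) R))"

lemma back_forth_subset: "back_forth k d R \<Longrightarrow> R' \<subseteq> R \<Longrightarrow> back_forth k d R'"
proof (induction k arbitrary: R R')
  case 0
  then show ?case by (auto simp: partial_iso_def)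
next
  case (Suc k)
  then show ?case by simp (meson insert_mono)
qed

lemma back_forth_decrease: "back_forth (n + k) d R \<Longrightarrow> back_forth k d R"
proof (induction n)
  case (Suc n)
  \<comment> \<open>A surplus round is spent on an arbitrary move and its pair is then
    forgotten.\<close>
  then have "\<exists>b. back_forth (n + k) d (insert (undefined, b) R)" by simp
  then have "back_forth (n + k) d R" by (auto elim: back_forth_subset)
  then show ?case by (rule Suc.IH)
qed simp

lemma back_forth_partial_iso: "back_forth k d R \<Longrightarrow> partial_iso d R"
  using back_forth_decrease[of k 0] by simp

text \<open>An element below \<open>d\<close> can only be answered by itself, so placing it on the
  board costs one round.\<close>

lemma back_forth_named:
  assumes "back_forth (Suc k) d R" "a \<prec> d"
  shows "back_forth k d (insert (a, a) R)"
proof -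
  obtain b where b: "back_forth k d (insert (a, b) R)" using assms(1) by auto
  from back_forth_partial_iso[OF this] have "a = b"
    using partial_isoD(1) assms(2) by blast
  with b show ?thesis by simp
qed

text \<open>One round for each constant 0 or 1 and each operation; variables and parameters are
  already on the board.\<close>

primrec rounds_tm :: "'a tm \<Rightarrow> nat" where
  "rounds_tm (Var i) = 0"
| "rounds_tm (Par p) = 0"
| "rounds_tm \<^bold>0 = 1"
| "rounds_tm \<^bold>1 = 1"
| "rounds_tm (s \<^bold>+ t) = Suc (rounds_tm s + rounds_tm t)"
| "rounds_tm (s \<^bold>* t) = Suc (rounds_tm s + rounds_tm t)"

text \<open>When the value of a compound term is played, preservation of the graphs of sum and
  product forces the reply to be the value on the other side.\<close>

lemma back_forth_term:
  assumes "back_forth (rounds_tm t + k) d R" "Id_on (tm_params t) \<subseteq> R"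
    and "\<And>i. i \<in> fv_tm t \<Longrightarrow> (e i, e' i) \<in> R"
  shows "back_forth k d (insert (val M e t, val M e' t) R)"
  using assms
proof (induction t arbitrary: k R)
  case (Var i)
  then show ?case by (simp add: insert_absorb)
next
  case (Par p)
  then have "(p, p) \<in> R" by auto
  with Par show ?case by (simp add: insert_absorb)
next
  case Zero
  then obtain b where b: "back_forth k d (insert (\<zero>, b) R)" by auto
  from back_forth_partial_iso[OF this] have "b = \<zero>"
    using partial_isoD(2)[of d _ \<zero> b] by simp
  with b show ?case by simp
next
  case One
  then obtain b where b: "back_forth k d (insert (\<one>, b) R)" by auto
  from back_forth_partial_iso[OF this] have "b = \<one>"
    using partial_isoD(3)[of d _ \<one> b] by simp
  with b show ?case by simp
next
  case (Plus s t)
  let ?R = "insert (val M e t, val M e' t) (insert (val M e s, val M e' s) R)"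
  have "back_forth (rounds_tm t + Suc k) d (insert (val M e s, val M e' s) R)"
    by (rule Plus.IH(1)) (use Plus.prems in \<open>auto simp: ac_simps\<close>)
  then have "back_forth (Suc k) d ?R"
    by (rule Plus.IH(2)) (use Plus.prems in auto)
  then obtain b where b: "back_forth k d (insert (val M e (s \<^bold>+ t), b) ?R)" by auto
  from partial_isoD(6)[OF back_forth_partial_iso[OF this], of "val M e s" "val M e' s"
      "val M e t" "val M e' t" "val M e (s \<^bold>+ t)" b]
  have "b = val M e' (s \<^bold>+ t)" by simp
  with b show ?case by (auto elim: back_forth_subset)
next
  case (Times s t)
  let ?R = "insert (val M e t, val M e' t) (insert (val M e s, val M e' s) R)"
  have "back_forth (rounds_tm t + Suc k) d (insert (val M e s, val M e' s) R)"
    by (rule Times.IH(1)) (use Times.prems in \<open>auto simp: ac_simps\<close>)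
  then have "back_forth (Suc k) d ?R"
    by (rule Times.IH(2)) (use Times.prems in auto)
  then obtain b where b: "back_forth k d (insert (val M e (s \<^bold>* t), b) ?R)" by auto
  from partial_isoD(7)[OF back_forth_partial_iso[OF this], of "val M e s" "val M e' s"
      "val M e t" "val M e' t" "val M e (s \<^bold>* t)" b]
  have "b = val M e' (s \<^bold>* t)" by simp
  with b show ?case by (auto elim: back_forth_subset)
qed

lemma partial_iso_two_terms:
  assumes "back_forth (rounds_tm s + rounds_tm t) d R" "Id_on (tm_params s \<union> tm_params t) \<subseteq> R"
    and "\<And>i. i \<in> fv_tm s \<union> fv_tm t \<Longrightarrow> (e i, e' i) \<in> R"
  shows "partial_iso d (insert (val M e t, val M e' t) (insert (val M e s, val M e' s) R))"
proof -
  have "back_forth (rounds_tm t + 0) d (insert (val M e s, val M e' s) R)"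
    by (rule back_forth_term) (use assms in auto)
  then have "back_forth 0 d (insert (val M e t, val M e' t) (insert (val M e s, val M e' s) R))"
    by (rule back_forth_term) (use assms in auto)
  then show ?thesis by simp
qed

text \<open>A generous bound: conjunctions add where a maximum would do. Atoms with S cost nothing,
  as S is empty wherever the bound is applied.\<close>

primrec rounds :: "'a fm \<Rightarrow> nat" where
  "rounds (s \<^bold>= t) = rounds_tm s + rounds_tm t"
| "rounds (s \<^bold>< t) = rounds_tm s + rounds_tm t"
| "rounds (TPred t) = rounds_tm t"
| "rounds (SPred s t) = 0"
| "rounds (\<^bold>\<not> \<phi>) = rounds \<phi>"
| "rounds (\<phi> \<^bold>\<and> \<psi>) = rounds \<phi> + rounds \<psi>"
| "rounds (Forall \<phi>) = Suc (rounds \<phi>)"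

text \<open>All elements of \<open>T\<close> lie below \<open>d\<close> and are therefore named, so
  a won position preserves membership in \<open>T\<close> along with arithmetic. A quantifier
  consumes one round, and the parameters of the formula are fixed by \<open>R\<close>.\<close>

lemma back_forth_sat:
  assumes "back_forth (rounds \<phi>) d R" "Id_on (params \<phi>) \<subseteq> R"
    and "\<And>i. i \<in> fv \<phi> \<Longrightarrow> (e i, e' i) \<in> R" "T \<subseteq> {x. x \<prec> d}"
  shows "sat M T {} e \<phi> = sat M T {} e' \<phi>"
  using assms
proof (induction \<phi> arbitrary: R e e')
  case (Eq s t)
  then have "partial_iso d (insert (val M e t, val M e' t) (insert (val M e s, val M e' s) R))"
    by (intro partial_iso_two_terms) auto
  from partial_isoD(4)[OF this, of "val M e s" "val M e' s" "val M e t" "val M e' t"]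
  show ?case by simp
next
  case (Less s t)
  then have "partial_iso d (insert (val M e t, val M e' t) (insert (val M e s, val M e' s) R))"
    by (intro partial_iso_two_terms) auto
  from partial_isoD(5)[OF this, of "val M e s" "val M e' s" "val M e t" "val M e' t"]
  show ?case by simp
next
  case (TPred t)
  have "back_forth 0 d (insert (val M e t, val M e' t) R)"
    by (rule back_forth_term) (use TPred in auto)
  then have "partial_iso d (insert (val M e t, val M e' t) R)" by simp
  from partial_isoD(1)[OF this, of "val M e t" "val M e' t"] TPred.prems(4)
  show ?case by auto
next
  case (Neg \<phi>)
  have "sat M T {} e \<phi> = sat M T {} e' \<phi>"
    by (rule Neg.IH) (use Neg.prems in auto)
  then show ?case by simp
next
  case (Conj \<phi> \<psi>)
  have "back_forth (rounds \<phi>) d R" "back_forth (rounds \<psi>) d R"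
    using Conj.prems(1) back_forth_decrease[of "rounds \<psi>" "rounds \<phi>"]
      back_forth_decrease[of "rounds \<phi>" "rounds \<psi>"] by (auto simp: ac_simps)
  then have "sat M T {} e \<phi> = sat M T {} e' \<phi>" "sat M T {} e \<psi> = sat M T {} e' \<psi>"
    using Conj.prems Conj.IH[of R e e'] by auto
  then show ?case by simp
next
  case (Forall \<phi>)
  have "sat M T {} (case_nat a e) \<phi> = sat M T {} (case_nat b e') \<phi>"
    if "back_forth (rounds \<phi>) d (insert (a, b) R)" for a b
    by (rule Forall.IH[OF that]) (use Forall.prems in \<open>auto split: nat.split\<close>)
  then show ?case using Forall.prems(1) by simp metis
qed simp

text \<open>Six rounds: two for the components, four for evaluating the pairing term on the reply.\<close>

lemma back_forth_unpair:
  assumes "back_forth (6 + k) d R" "(pair a b, pair a b) \<in> R"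
  shows "back_forth k d (insert (a, a) (insert (b, b) R))"
proof -
  let ?t = "pair_tm (Var 0) (Var 1)"
  have "back_forth (Suc (Suc (rounds_tm ?t + k))) d R"
    using assms(1) by (simp add: pair_tm_def eval_nat_numeral)
  then obtain a' b' where R': "back_forth (rounds_tm ?t + k) d (insert (b, b') (insert (a, a') R))"
    (is "back_forth _ _ ?R'") unfolding back_forth.simps by meson
  let ?e = "\<lambda>i::nat. if i = 0 then a else b" and ?e' = "\<lambda>i::nat. if i = 0 then a' else b'"
  have "back_forth k d (insert (val M ?e ?t, val M ?e' ?t) ?R')"
    by (rule back_forth_term[OF R']) auto
  then have k: "back_forth k d (insert (pair a b, pair a' b') ?R')" by simp
  \<comment> \<open>The computed pair is matched with \<open>pair a' b'\<close>, but
    \<open>pair a b\<close> is also matched with itself. Hence both values agree, and injectivity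
    makes the replies equal to the moves.\<close>
  from partial_isoD(4)[OF back_forth_partial_iso[OF k], of "pair a b" "pair a' b'" "pair a b" "pair a b"]
  have "pair a b = pair a' b'" using assms(2) by simp
  with k show ?thesis by (auto simp: pair_inject elim: back_forth_subset)
qed

text \<open>The code of a list is an iterated pair, and each entry is split off in six
  rounds.\<close>

lemma back_forth_unpair_list:
  assumes "back_forth (length ps * 6 + k) d R" "(foldr pair ps a, foldr pair ps a) \<in> R"
  shows "back_forth k d (R \<union> Id_on (set ps))"
  using assms
proof (induction ps arbitrary: R)
  case (Cons p ps)
  let ?w = "foldr pair ps a"
  have "back_forth (length ps * 6 + k) d (insert (p, p) (insert (?w, ?w) R))"
    by (rule back_forth_unpair) (use Cons.prems in \<open>simp_all add: ac_simps\<close>)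
  then have "back_forth k d (insert (p, p) (insert (?w, ?w) R) \<union> Id_on (set ps))"
    by (rule Cons.IH) simp
  then show ?case by (rule back_forth_subset) auto
qed simp

section \<open>Expressing the game by arithmetical formulas\<close>

definition Conjs :: "'a fm list \<Rightarrow> 'a fm"
  where "Conjs fs = foldr Conj fs (\<^bold>0 \<^bold>= \<^bold>0)"

lemma Conjs_simps [simp]:
  "sat N T S e (Conjs fs) \<longleftrightarrow> (\<forall>\<phi>\<in>set fs. sat N T S e \<phi>)"
  "Conjs fs \<in> LPA \<longleftrightarrow> set fs \<subseteq> LPA"
  "fv (Conjs fs) = (\<Union>\<phi>\<in>set fs. fv \<phi>)"
  by (induction fs) (auto simp: Conjs_def)

definition agree_fm :: "nat \<Rightarrow> nat \<times> nat \<Rightarrow> nat \<times> nat \<Rightarrow> nat \<times> nat \<Rightarrow> 'a fm" where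
  "agree_fm d = (\<lambda>(a, b) (a', b') (a'', b''). Conjs
     [Var a \<^bold>< Var d \<^bold>\<longrightarrow> Var a \<^bold>= Var b, Var b \<^bold>< Var d \<^bold>\<longrightarrow> Var a \<^bold>= Var b,
      Var a \<^bold>= \<^bold>0 \<^bold>\<longleftrightarrow> Var b \<^bold>= \<^bold>0, Var a \<^bold>= \<^bold>1 \<^bold>\<longleftrightarrow> Var b \<^bold>= \<^bold>1,
      Var a \<^bold>= Var a' \<^bold>\<longleftrightarrow> Var b \<^bold>= Var b', Var a \<^bold>< Var a' \<^bold>\<longleftrightarrow> Var b \<^bold>< Var b',
      Var a \<^bold>+ Var a' \<^bold>= Var a'' \<^bold>\<longleftrightarrow> Var b \<^bold>+ Var b' \<^bold>= Var b'',
      Var a \<^bold>* Var a' \<^bold>= Var a'' \<^bold>\<longleftrightarrow> Var b \<^bold>* Var b' \<^bold>= Var b''])"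

lemma sat_Iff: "sat N T S e (\<phi> \<^bold>\<longleftrightarrow> \<psi>) \<longleftrightarrow> sat N T S e \<phi> = sat N T S e \<psi>"
  by auto

lemma sat_agree_fm:
  "sat M T S e (agree_fm d x y z) \<longleftrightarrow> agree (e d) (map_prod e e x) (map_prod e e y) (map_prod e e z)"
  unfolding agree_fm_def agree_def split_beta Conjs_simps list.set ball_simps sat_Iff by simp

lemma agree_fm_in_LPA: "agree_fm d x y z \<in> LPA"
  by (simp add: agree_fm_def split_beta)

lemma fv_agree_fm:
  "fv (agree_fm d x y z) \<subseteq> {d, fst x, snd x, fst y, snd y, fst z, snd z}"
  by (auto simp: agree_fm_def split_beta)

definition partial_iso_fm :: "nat \<Rightarrow> (nat \<times> nat) list \<Rightarrow> 'a fm" where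
  "partial_iso_fm d ps = Conjs (concat (map (\<lambda>x. concat (map (\<lambda>y. map (agree_fm d x y) ps) ps)) ps))"

text \<open>The number of rounds is external, one formula for each \<open>k\<close>, whereas the
  bound \<open>d\<close> is a variable. Of the two new variables 1 is the move and 0 the reply;
  older indices shift by two.\<close>

primrec back_forth_fm :: "nat \<Rightarrow> nat \<Rightarrow> (nat \<times> nat) list \<Rightarrow> 'a fm" where
  "back_forth_fm 0 d ps = partial_iso_fm d ps"
| "back_forth_fm (Suc k) d ps =
     (Forall (Exists (back_forth_fm k (d + 2) ((1, 0) # map (map_prod (\<lambda>i. i + 2) (\<lambda>i. i + 2)) ps)))
   \<^bold>\<and> Forall (Exists (back_forth_fm k (d + 2) ((0, 1) # map (map_prod (\<lambda>i. i + 2) (\<lambda>i. i + 2)) ps))))"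

lemma sat_partial_iso_fm:
  "sat M T S e (partial_iso_fm d ps) \<longleftrightarrow> partial_iso (e d) (map_prod e e ` set ps)"
  by (auto simp: partial_iso_fm_def partial_iso_def sat_agree_fm)

lemma sat_back_forth_fm:
  "sat M T S e (back_forth_fm k d ps) \<longleftrightarrow> back_forth k (e d) (map_prod e e ` set ps)"
proof (induction k arbitrary: d ps e)
  case (Suc k)
  have "map_prod (case_nat b (case_nat a e)) (case_nat b (case_nat a e))
        ` map_prod (\<lambda>i. i + 2) (\<lambda>i. i + 2) ` set ps = map_prod e e ` set ps" for a b
    by (simp add: image_image split_beta map_prod_def)
  then show ?case by (simp add: Suc)
qed (simp add: sat_partial_iso_fm)

lemma back_forth_fm_in_LPA: "back_forth_fm k d ps \<in> LPA"
  by (induction k arbitrary: d ps) (auto simp: partial_iso_fm_def agree_fm_in_LPA)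

lemma fv_back_forth_fm: "fv (back_forth_fm k d ps) \<subseteq> insert d (fst ` set ps \<union> snd ` set ps)"
proof (induction k arbitrary: d ps)
  case 0
  have "fv (agree_fm d x y z) \<subseteq> insert d (fst ` set ps \<union> snd ` set ps)"
    if "x \<in> set ps" "y \<in> set ps" "z \<in> set ps" for x y z
    using fv_agree_fm[of d x y z] that by blast
  then show ?case by (simp add: partial_iso_fm_def UN_subset_iff)
next
  case (Suc k)
  have "i \<in> insert d (fst ` set ps \<union> snd ` set ps)"
    if "Suc (Suc i) \<in> fv (back_forth_fm k (d + 2) ((a, b) # map (map_prod (\<lambda>i. i + 2) (\<lambda>i. i + 2)) ps))"
      "a < 2" "b < 2" for a b i
  proof -
    have "Suc (Suc i) \<in> insert (d + 2) (fst ` set ((a, b) # map (map_prod (\<lambda>i. i + 2) (\<lambda>i. i + 2)) ps)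
        \<union> snd ` set ((a, b) # map (map_prod (\<lambda>i. i + 2) (\<lambda>i. i + 2)) ps))"
      using Suc that(1) by blast
    with that(2,3) show ?thesis by (auto simp: image_iff)
  qed
  from this[of _ 1 0] this[of _ 0 1] show ?case by auto
qed

section \<open>Finitely many game classes over a finite set of names\<close>

text \<open>A tuple is classified by its named entries and its atomic diagram; with finitely many
  names both range over finite sets.\<close>

lemma finite_index_partial_iso:
  assumes "finite {x. x \<prec> d}"
  shows "\<exists>f :: 'a list \<Rightarrow> nat. finite (f ` {xs. length xs = n})
    \<and> (\<forall>xs ys. length xs = n \<longrightarrow> length ys = n \<longrightarrow> f xs = f ys \<longrightarrow> partial_iso d (set (zip xs ys)))"
proof -
  define named where "named x = (if x \<prec> d then Some x else None)" for x
  \<comment> \<open>Each truth value carries its own tag, so equality of these sets means equality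
    of all six truth values.\<close>
  define atom where "atom a b c = {(0::nat, a = \<zero>), (1, a = \<one>), (2, a = b), (3, a \<prec> b),
    (4, a \<oplus> b = c), (5, a \<otimes> b = c)}" for a b c
  define diagram where "diagram xs = {((i, j, l), t). i < n \<and> j < n \<and> l < n
    \<and> t \<in> atom (xs ! i) (xs ! j) (xs ! l)}" for xs
  define g where "g xs = (map named xs, diagram xs)" for xs
  have "finite (g ` {xs. length xs = n})"
  proof (rule finite_subset)
    let ?N = "insert None (Some ` {x. x \<prec> d})"
    let ?D = "({..<n} \<times> {..<n} \<times> {..<n}) \<times> ({..<6 :: nat} \<times> (UNIV :: bool set))"
    show "g ` {xs. length xs = n} \<subseteq> {ys. set ys \<subseteq> ?N \<and> length ys = n} \<times> Pow ?D"
      by (auto simp: g_def diagram_def named_def atom_def)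
    have "finite {ys. set ys \<subseteq> ?N \<and> length ys = n}"
      by (rule finite_lists_length_eq) (use assms in auto)
    then show "finite ({ys. set ys \<subseteq> ?N \<and> length ys = n} \<times> Pow ?D)" by simp
  qed
  then obtain f :: "'a list \<Rightarrow> nat" where f: "finite (f ` {xs. length xs = n})"
    "\<And>xs ys. length xs = n \<Longrightarrow> length ys = n \<Longrightarrow> f xs = f ys \<Longrightarrow> g xs = g ys"
    using finite_range_to_nat[of g "{xs. length xs = n}"] by auto
  have "partial_iso d (set (zip xs ys))" if l: "length xs = n" "length ys = n" and "f xs = f ys" for xs ys
  proof -
    have eq: "map named xs = map named ys" "diagram xs = diagram ys"
      using f(2)[of xs ys] that by (simp_all add: g_def)
    have nm: "named (xs ! i) = named (ys ! i)" if "i < n" for i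
      using eq(1) that l by (metis nth_map)
    have at: "atom (xs ! i) (xs ! j) (xs ! m) = atom (ys ! i) (ys ! j) (ys ! m)"
      if "i < n" "j < n" "m < n" for i j m
    proof -
      have "((i, j, m), t) \<in> diagram xs \<longleftrightarrow> ((i, j, m), t) \<in> diagram ys" for t
        using eq(2) by simp
      with that show ?thesis unfolding diagram_def by (intro set_eqI) simp
    qed
    have "agree d (xs ! i, ys ! i) (xs ! j, ys ! j) (xs ! m, ys ! m)"
      if "i < n" "j < n" "m < n" for i j m
    proof -
      have "(t \<in> atom (xs ! i) (xs ! j) (xs ! m)) = (t \<in> atom (ys ! i) (ys ! j) (ys ! m))" for t
        using at[OF that] by simp
      from this[of "(0, True)"] this[of "(1, True)"] this[of "(2, True)"] this[of "(3, True)"]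
        this[of "(4, True)"] this[of "(5, True)"]
      show ?thesis using nm[OF that(1)] by (simp add: agree_def atom_def named_def split: if_splits)
    qed
    then show ?thesis
      unfolding partial_iso_def set_zip using l by auto
  qed
  with f(1) show ?thesis by blast
qed

text \<open>The class of a tuple for \<open>k + 1\<close> rounds is the set of classes for
  \<open>k\<close> rounds of its extensions by one element. Equality of these sets supplies replies
  in both directions.\<close>

lemma finite_index_back_forth:
  assumes "finite {x. x \<prec> d}"
  shows "\<exists>f :: 'a list \<Rightarrow> nat. finite (f ` {xs. length xs = n})
    \<and> (\<forall>xs ys. length xs = n \<longrightarrow> length ys = n \<longrightarrow> f xs = f ys \<longrightarrow> back_forth k d (set (zip xs ys)))"
proof (induction k arbitrary: n)
  case 0
  show ?case using finite_index_partial_iso[OF assms] by simp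
next
  case (Suc k)
  obtain f :: "'a list \<Rightarrow> nat" where f: "finite (f ` {xs. length xs = Suc n})"
    "\<And>xs ys. length xs = Suc n \<Longrightarrow> length ys = Suc n \<Longrightarrow> f xs = f ys \<Longrightarrow> back_forth k d (set (zip xs ys))"
    using Suc[of "Suc n"] by blast
  define g where "g xs = range (\<lambda>a. f (a # xs))" for xs
  have "g ` {xs. length xs = n} \<subseteq> Pow (f ` {xs. length xs = Suc n})"
    by (auto simp: g_def)
  then have "finite (g ` {xs. length xs = n})"
    using f(1) finite_subset by blast
  then obtain h :: "'a list \<Rightarrow> nat" where h: "finite (h ` {xs. length xs = n})"
    "\<And>xs ys. length xs = n \<Longrightarrow> length ys = n \<Longrightarrow> h xs = h ys \<Longrightarrow> g xs = g ys"
    using finite_range_to_nat[of g "{xs. length xs = n}"] by auto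
  have "back_forth (Suc k) d (set (zip xs ys))"
    if l: "length xs = n" "length ys = n" and "h xs = h ys" for xs ys
  proof -
    have eq: "range (\<lambda>a. f (a # xs)) = range (\<lambda>b. f (b # ys))"
      using h(2)[of xs ys] that by (simp add: g_def)
    have step: "back_forth k d (insert (a, b) (set (zip xs ys)))" if "f (a # xs) = f (b # ys)" for a b
      using f(2)[of "a # xs" "b # ys"] that l by simp
    have "\<exists>b. f (a # xs) = f (b # ys)" for a using eq by (metis (no_types, lifting) rangeE rangeI)
    moreover have "\<exists>a. f (a # xs) = f (b # ys)" for b
      using eq by (metis (no_types, lifting) rangeE rangeI)
    ultimately show ?thesis using step by (simp) metis
  qed
  with h(1) show ?case by blast
qed

section \<open>Repeated game classes\<close>

text \<open>The pair \<open>(w, w)\<close> stays on the board so that the bound and the parameters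
  can be recovered from it by unpairing.\<close>

definition repeats :: "nat \<Rightarrow> 'a \<Rightarrow> 'a \<Rightarrow> 'a \<Rightarrow> bool" where
  "repeats k v p z \<longleftrightarrow> (\<exists>w u u' z'. w = pair v p \<and> z = pair u w \<and> z' = pair u' w \<and> z' \<prec> z
     \<and> back_forth k v {(z, z'), (w, w)})"

text \<open>Inside the four quantifiers 3, 2, 1, 0 stand for \<open>w\<close>, \<open>u\<close>,
  \<open>u'\<close>, \<open>z'\<close>, and the outer variables shift by four.\<close>

definition repeats_fm :: "nat \<Rightarrow> nat \<Rightarrow> nat \<Rightarrow> nat \<Rightarrow> 'a fm" where
  "repeats_fm k v p z = Exists (Exists (Exists (Exists
     (Var 3 \<^bold>= pair_tm (Var (v + 4)) (Var (p + 4)) \<^bold>\<and> Var (z + 4) \<^bold>= pair_tm (Var 2) (Var 3)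
      \<^bold>\<and> Var 0 \<^bold>= pair_tm (Var 1) (Var 3) \<^bold>\<and> Var 0 \<^bold>< Var (z + 4)
      \<^bold>\<and> back_forth_fm k (v + 4) [(z + 4, 0), (3, 3)]))))"

lemma sat_repeats_fm: "sat M T S e (repeats_fm k v p z) \<longleftrightarrow> repeats k (e v) (e p) (e z)"
  by (simp add: repeats_fm_def repeats_def sat_back_forth_fm eval_nat_numeral) metis

lemma repeats_fm_in_LPA: "repeats_fm k v p z \<in> LPA"
  by (simp add: repeats_fm_def back_forth_fm_in_LPA)

lemma fv_repeats_fm: "fv (repeats_fm k v p z) \<subseteq> {v, p, z}"
  using fv_back_forth_fm[of k "v + 4" "[(z + 4, 0), (3, 3)]"] by (auto simp: repeats_fm_def)

text \<open>Pigeonhole: infinitely many \<open>u\<close> fall into finitely many classes.\<close>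

lemma ex_repeats_num: "\<exists>z. repeats k (num n) p z"
proof -
  define w where "w = pair (num n) p"
  obtain f :: "'a list \<Rightarrow> nat" where f: "finite (f ` {xs. length xs = 2})"
    "\<And>xs ys. length xs = 2 \<Longrightarrow> length ys = 2 \<Longrightarrow> f xs = f ys \<Longrightarrow> back_forth k (num n) (set (zip xs ys))"
    using finite_index_back_forth[OF finite_below_num[of n], of 2 k] by blast
  have inf: "infinite (range num)" using inj_num by (simp add: finite_image_iff)
  have "finite ((\<lambda>u. f [pair u w, w]) ` range num)"
    by (rule finite_subset[OF _ f(1)]) auto
  then have "\<not> inj_on (\<lambda>u. f [pair u w, w]) (range num)"
    using inf finite_imageD by blast
  then obtain u u' where uu': "u \<noteq> u'" "f [pair u w, w] = f [pair u' w, w]"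
    unfolding inj_on_def by blast
  \<comment> \<open>Both orders are recorded, since either of the two codes may be the larger
    one.\<close>
  then have "back_forth k (num n) {(pair u w, pair u' w), (w, w)}"
    "back_forth k (num n) {(pair u' w, pair u w), (w, w)}"
    using f(2)[of "[pair u w, w]" "[pair u' w, w]"] f(2)[of "[pair u' w, w]" "[pair u w, w]"] by auto
  moreover have "pair u w \<prec> pair u' w \<or> pair u' w \<prec> pair u w"
    using uu'(1) less_linear[of "pair u w" "pair u' w"] by (auto simp: pair_inject)
  ultimately show ?thesis unfolding repeats_def w_def by blast
qed

text \<open>Overspill: otherwise the bounds that admit a repetition would be exactly the standard
  elements, and induction would make every element standard.\<close>

lemma ex_repeats_nonstandard:
  assumes "nonstandard M"
  shows "\<exists>d z. d \<notin> range num \<and> repeats k d p z"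
proof (rule ccontr)
  assume not: "\<nexists>d z. d \<notin> range num \<and> repeats k d p z"
  \<comment> \<open>Below the quantifier 0 is the repetition, 1 the bound, and 2 reads
    \<open>p\<close> from the constant tail of the assignment.\<close>
  let ?\<phi> = "Exists (repeats_fm k 1 2 0)"
  have \<phi>: "sat M {} {} (case_nat v (\<lambda>_. p)) ?\<phi> \<longleftrightarrow> (\<exists>z. repeats k v p z)" for v
    by (simp add: sat_repeats_fm eval_nat_numeral)
  have "sat M {} {} (case_nat v (\<lambda>_. p)) ?\<phi>" for v
  proof (rule definable_induct)
    show "?\<phi> \<in> LPA" by (simp add: repeats_fm_in_LPA)
    show "sat M {} {} (case_nat \<zero> (\<lambda>_. p)) ?\<phi>" unfolding \<phi> using ex_repeats_num[of k 0] by simp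
    fix v assume "sat M {} {} (case_nat v (\<lambda>_. p)) ?\<phi>"
    then obtain n where "v = num n" unfolding \<phi> using not by blast
    then show "sat M {} {} (case_nat (v \<oplus> \<one>) (\<lambda>_. p)) ?\<phi>"
      unfolding \<phi> using ex_repeats_num[of k "Suc n" p] by simp
  qed
  then have "v \<in> range num" for v unfolding \<phi> using not by blast
  then have "surj num" by blast
  with assms surj_num_imp_standard show False by blast
qed

section \<open>Undefinability from a set of standard elements\<close>

lemma standard_set_not_defines_USB:
  assumes "nonstandard M" "T \<subseteq> range num"
  shows "\<not> syntactically_defines_USB (ElDiag M T)"
proof
  assume "syntactically_defines_USB (ElDiag M T)"
  then obtain \<theta> where fv: "fv \<theta> \<subseteq> {0, 1}"
    and USB: "\<And>\<Phi>. \<Phi> \<in> USB \<Longrightarrow> true_in_expansion M T (replace_S \<theta> \<Phi>)"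
    unfolding syntactically_defines_USB_ElDiag by blast
  \<comment> \<open>The USB biconditionals say that \<open>\<theta>\<close>, at a Goedel number,
    decides satisfaction of the coded formula.\<close>
  have \<theta>: "sat M T {} (\<lambda>i. if i = 0 then num (goedel \<phi>) else a) \<theta> = sat M {} {} (\<lambda>_. a) \<phi>"
    if \<phi>: "\<phi> \<in> LPA" "fv \<phi> \<subseteq> {0}" for \<phi> :: "'a fm" and a
  proof -
    have "Forall (SPred (numeral_tm (goedel \<phi>)) (Var 0) \<^bold>\<longleftrightarrow> \<phi>) \<in> USB"
      using \<phi> by (auto simp: USB_def)
    from USB[OF this] have "sat M T {} (case_nat a (\<lambda>_. a))
        (subst (\<lambda>i. if i = 0 then numeral_tm (goedel \<phi>) else Var 0) \<theta> \<^bold>\<longleftrightarrow> \<phi>)"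
      unfolding true_in_expansion_def replace_S.simps replace_S_LPA[OF \<phi>(1)] sat.simps(7) by blast
    then have main: "sat M T {} (\<lambda>i. val M (case_nat a (\<lambda>_. a)) (if i = 0 then numeral_tm (goedel \<phi>) else Var 0)) \<theta>
        = sat M T {} (case_nat a (\<lambda>_. a)) \<phi>"
      unfolding sat_Iff sat_subst .
    have c: "case_nat a (\<lambda>_. a) = (\<lambda>_. a)"
      by (auto simp: fun_eq_iff split: nat.split)
    have e: "(\<lambda>i. val M (\<lambda>_. a) (if i = 0 then numeral_tm (goedel \<phi>) else Var 0))
        = (\<lambda>i. if i = 0 then num (goedel \<phi>) else a)"
      by (auto simp: fun_eq_iff)
    show ?thesis using main unfolding c e sat_LPA[OF \<phi>(1), of M T] .
  qed
  obtain ps where ps: "set ps = params \<theta>" using finite_list[OF finite_params[of \<theta>]] by blast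
  define p where "p = foldr pair ps \<zero>"
  \<comment> \<open>The budget: six rounds to split \<open>w\<close> into \<open>d\<close> and
    \<open>p\<close>, six for each parameter, one for the Goedel number, and the rest for
    \<open>\<theta>\<close>.\<close>
  define K where "K = 6 + (length ps * 6 + Suc (rounds \<theta>))"
  obtain d z\<^sub>0 where d: "d \<notin> range num" and "repeats K d p z\<^sub>0"
    using ex_repeats_nonstandard[OF assms(1)] by blast
  then obtain z where z: "repeats K d p z" and least: "\<And>y. y \<prec> z \<Longrightarrow> \<not> repeats K d p y"
    using definable_least[OF repeats_fm_in_LPA[of K 1 2 0], of _ "case_nat d (\<lambda>_. p)"]
    by (simp add: sat_repeats_fm eval_nat_numeral) metis
  from z obtain w u u' z' where w: "w = pair d p" and zu: "z = pair u w" "z' = pair u' w" "z' \<prec> z"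
    and R: "back_forth K d {(z, z'), (w, w)}"
    unfolding repeats_def by blast
  \<comment> \<open>USB only offers formulas in one variable without parameters. So bound and
    parameter code are quantified; the element itself determines them.\<close>
  let ?\<phi> = "Exists (Exists (repeats_fm K 1 0 2))"
  have \<phi>: "?\<phi> \<in> LPA" "fv ?\<phi> \<subseteq> {0}"
    using fv_repeats_fm[of K 1 0 2] by (auto simp: repeats_fm_in_LPA)
  have sat_\<phi>: "sat M {} {} (\<lambda>_. y) ?\<phi> \<longleftrightarrow> (\<exists>v q. repeats K v q y)" for y
    by (simp add: sat_repeats_fm eval_nat_numeral)
  have "\<not> repeats K v q z'" for v q
  proof
    assume r: "repeats K v q z'"
    \<comment> \<open>Injectivity of pairing reads the bound and the parameter code off
      \<open>z'\<close>, so the minimality of \<open>z\<close> applies.\<close>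
    then have "v = d \<and> q = p" unfolding repeats_def by (auto simp: zu w pair_inject)
    with r least zu(3) show False by blast
  qed
  then have "sat M {} {} (\<lambda>_. z) ?\<phi> \<noteq> sat M {} {} (\<lambda>_. z') ?\<phi>"
    unfolding sat_\<phi> using z by blast
  moreover have "sat M T {} (\<lambda>i. if i = 0 then num (goedel ?\<phi>) else z) \<theta>
      = sat M T {} (\<lambda>i. if i = 0 then num (goedel ?\<phi>) else z') \<theta>"
  proof (rule back_forth_sat)
    let ?g = "num (goedel ?\<phi>)"
    let ?R = "insert (d, d) (insert (p, p) {(z, z'), (w, w)})"
    have "back_forth (length ps * 6 + Suc (rounds \<theta>)) d ?R"
      by (rule back_forth_unpair) (use R in \<open>simp_all add: K_def w\<close>)
    then have "back_forth (Suc (rounds \<theta>)) d (?R \<union> Id_on (set ps))"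
      by (rule back_forth_unpair_list[of _ _ _ _ \<zero>]) (simp add: p_def)
    \<comment> \<open>The Goedel number is standard, hence below the nonstandard \<open>d\<close>
      and named.\<close>
    then show "back_forth (rounds \<theta>) d (insert (?g, ?g) (?R \<union> Id_on (set ps)))"
      by (rule back_forth_named) (rule num_less_nonstandard[OF d])
    show "T \<subseteq> {x. x \<prec> d}" using assms(2) num_less_nonstandard[OF d] by auto
  qed (use fv ps in auto)
  ultimately show False unfolding \<theta>[OF \<phi>] by blast
qed

section \<open>The set of codes of true sentences\<close>

text \<open>Induction is required only for formulas without T, so PA survives any choice of
  \<open>T\<close>. The biconditionals hold because \<open>goedel\<close> on \<open>LPA\<close> and
  \<open>num\<close> are injective.\<close>

lemma true_sentences_TB:
  assumes "T = {num (goedel \<phi>) | \<phi> :: 'a fm. \<phi> \<in> LPA \<and> sentence \<phi> \<and> true_in M \<phi>}" "\<Phi> \<in> TB"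
  shows "true_in_expansion M T \<Phi>"
proof (cases "\<Phi> \<in> PA")
  case True
  then show ?thesis
    using PA_true[OF True] PA_subset_LPA sat_LPA[of \<Phi> M T "{}"]
    by (auto simp: true_in_def true_in_expansion_def)
next
  case False
  with assms(2) obtain \<phi> where \<phi>: "\<phi> \<in> LPA" "sentence \<phi>"
    and \<Phi>: "\<Phi> = (TPred (numeral_tm (goedel \<phi>)) \<^bold>\<longleftrightarrow> \<phi>)"
    by (auto simp: TB_def)
  have "num (goedel \<phi>) \<in> T \<longleftrightarrow> true_in M \<phi>"
    using \<phi> inj_on_goedel inj_eq[OF inj_num] by (auto simp: assms(1) dest: inj_onD)
  \<comment> \<open>A sentence has the same truth value under all assignments, so the universal one
    in \<open>true_in\<close> can be read at any single \<open>e\<close>.\<close>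
  moreover have "true_in M \<phi> \<longleftrightarrow> sat M T {} e \<phi>" for e
    using sat_cong[of \<phi>] \<phi>(2) sat_LPA[OF \<phi>(1)] unfolding true_in_def by blast
  ultimately show ?thesis by (auto simp: true_in_expansion_def \<Phi>)
qed

end

theorem proposition54:
  fixes M :: "'a arith_structure"
  assumes "\<forall>\<Phi>\<in>PA. true_in M \<Phi>"
    and "nonstandard M"
  shows "\<exists>T :: 'a set. (\<forall>\<Phi>\<in>TB. true_in_expansion M T \<Phi>)
           \<and> \<not> syntactically_defines_USB (ElDiag M T)"
proof -
  interpret pa_model M using assms(1) by unfold_locales blast
  let ?T = "{num (goedel \<phi>) | \<phi> :: 'a fm. \<phi> \<in> LPA \<and> sentence \<phi> \<and> true_in M \<phi>}"
  have "?T \<subseteq> range num" by blast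
  then have "\<not> syntactically_defines_USB (ElDiag M ?T)"
    by (rule standard_set_not_defines_USB[OF assms(2)])
  moreover have "\<forall>\<Phi>\<in>TB. true_in_expansion M ?T \<Phi>"
    using true_sentences_TB[OF refl] by blast
  ultimately show ?thesis by blast
qed

end
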